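(* Let $(R,\mu)$ be a $\sigma$-finite nonatomic measure space with $\mu(R)=\infty$, and let $A$ and $B$ be Young functions. Then $$L^B(R,\mu)\overset{*}{\underset{\infty}{\hookrightarrow}}L^A(R,\mu)\quad\text{if and only if}\quad A\ll_0 B.$$
   Context: All sets $E\subseteq R$ are understood to be $\mu$-measurable. A Young function is a function $A\colon[0,\infty]\to[0,\infty]$ that is left-continuous and convex on $[0,\infty)$, satisfies $A(0)=0$, and is not identically constant on $(0,\infty)$. The Orlicz norm is $\|f\|_{L^A(R,\mu)}=\inf\{\lambda>0:\int_R A(|f(x)|/\lambda)\,d\mu(x)\le1\}$ for $\mu$-measurable $f$, and $L^A(R,\mu)$ is the space of $\mu$-measurable $f$ with finite norm. For Young functions $A,B$, $A\ll_0B$ ("$B$ essentially dominates $A$ near zero") means that $B(t)>0$ for every $t>0$ and $\lim_{t\to0_+}A(\lambda t)/B(t)=0$ for every $\lambda>0$. For function spaces $X,Y$ over $(R,\mu)$, write $X\overset{*}{\underset{\infty}{\hookrightarrow}}Y$ if $$\lim_{a\to\infty}\sup_{\|f\|_X\le1}\ \inf_{E\subseteq R,\ \mu(E)\le a}\|f\chi_{R\setminus E}\|_Y=0.$$ *)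

theory Defs
  imports "HOL-Analysis.Analysis"
begin

definition atom_of :: "'a measure \<Rightarrow> 'a set \<Rightarrow> bool" where
  "atom_of M S \<longleftrightarrow> S \<in> sets M \<and> emeasure M S > 0 \<and>
     (\<forall>T\<in>sets M. T \<subseteq> S \<longrightarrow> emeasure M T = 0 \<or> emeasure M T = emeasure M S)"

definition nonatomic :: "'a measure \<Rightarrow> bool" where
  "nonatomic M \<longleftrightarrow> (\<nexists>S. atom_of M S)"

text \<open>
  Left-continuity is required at every point of the domain \<open>[0, \<infinity>]\<close>, including \<open>\<infinity>\<close>;
  it is vacuous at \<open>0\<close>, where \<^term>\<open>at_left (0::ennreal)\<close> is the trivial filter.
  The value \<open>\<infinity>\<close> is allowed; since \<open>0 * \<infinity> = 0\<close> in \<^typ>\<open>ennreal\<close>, the convexity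
  inequality is trivial for \<open>u = 0\<close> and \<open>u = 1\<close>.
\<close>

definition young_function :: "(ennreal \<Rightarrow> ennreal) \<Rightarrow> bool" where
  "young_function A \<longleftrightarrow>
     A 0 = 0 \<and>
     (\<forall>t. (A \<longlongrightarrow> A t) (at_left t)) \<and>
     (\<forall>s t u. s < \<infinity> \<longrightarrow> t < \<infinity> \<longrightarrow> 0 \<le> u \<longrightarrow> u \<le> 1 \<longrightarrow>
        A (ennreal (1 - u) * s + ennreal u * t) \<le> ennreal (1 - u) * A s + ennreal u * A t) \<and>
     \<not> (\<exists>c. \<forall>t. 0 < t \<longrightarrow> t < \<infinity> \<longrightarrow> A t = c)"

text \<open>Measurable functions are extended-real valued; the norm is \<open>\<infinity>\<close> outside the Orlicz space.\<close>

definition orlicz_norm ::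
    "(ennreal \<Rightarrow> ennreal) \<Rightarrow> 'a measure \<Rightarrow> ('a \<Rightarrow> ereal) \<Rightarrow> ennreal" where
  "orlicz_norm A M f =
     Inf {ennreal r | r. 0 < r \<and> (\<integral>\<^sup>+ x. A (e2ennreal \<bar>f x\<bar> / ennreal r) \<partial>M) \<le> 1}"

definition essentially_dominated_near_zero ::
    "(ennreal \<Rightarrow> ennreal) \<Rightarrow> (ennreal \<Rightarrow> ennreal) \<Rightarrow> bool"  (infix \<open>\<lless>\<^sub>0\<close> 50) where
  "A \<lless>\<^sub>0 B \<longleftrightarrow>
     (\<forall>t>0. B t > 0) \<and>
     (\<forall>r>0. ((\<lambda>t::real. A (ennreal (r * t)) / B (ennreal t)) \<longlongrightarrow> 0) (at_right 0))"

text \<open>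
  A function space \<open>X\<close> over \<open>M\<close> is given by its norm \<open>X :: ('a \<Rightarrow> ereal) \<Rightarrow> ennreal\<close>:
  it consists of the measurable \<open>f\<close> with \<open>X f < \<infinity>\<close>.
\<close>

definition embeds_star_infinity ::
    "'a measure \<Rightarrow> (('a \<Rightarrow> ereal) \<Rightarrow> ennreal) \<Rightarrow> (('a \<Rightarrow> ereal) \<Rightarrow> ennreal) \<Rightarrow> bool" where
  "embeds_star_infinity M X Y \<longleftrightarrow>
     ((\<lambda>a::real. SUP f\<in>{f \<in> borel_measurable M. X f \<le> 1}.
          INF E\<in>{E \<in> sets M. emeasure M E \<le> ennreal a}.
            Y (\<lambda>x. f x * indicator (space M - E) x)) \<longlongrightarrow> 0) at_top"

end

theory Submission
  imports Defs
begin

text \<open>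
  If \<open>A \<lless>\<^sub>0 B\<close>, remove from \<open>f\<close> the set where \<open>\<bar>f\<bar> / 2 \<ge> \<delta>\<close>: by Markov's inequality its
  measure is at most \<open>1 / B \<delta>\<close>, and elsewhere \<open>A (r \<bar>f\<bar> / 2) \<le> B (\<bar>f\<bar> / 2)\<close> once \<open>\<delta>\<close> is
  small. Conversely, testing the embedding on a constant function shows \<open>B > 0\<close>, and testing it
  on \<open>t \<chi>\<^sub>G\<close> with \<open>\<mu> G\<close> comparable to \<open>1 / B t\<close>, which is large for small \<open>t\<close>, bounds \<open>A (r t)\<close>
  by a small multiple of \<open>B t\<close>. Sets of measure comparable to a prescribed value exist because the
  measure has no atoms.
\<close>

section \<open>Sets of prescribed size in nonatomic measures\<close>

text \<open>
  If no measure lies in \<open>[v / 2, v]\<close>, the sets of measure at most \<open>v\<close> are closed under unions, so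
  \<open>F\<close> contains a largest one, \<open>U\<close>. Subsets of \<open>F - U\<close> are then null or larger than \<open>v\<close>, and one
  whose measure is within \<open>v\<close> of the infimum of the nonzero values is an atom.
\<close>

lemma nonatomic_subset_comparable:
  fixes M :: "'a measure" and v :: real
  assumes na: "nonatomic M" and v: "0 < v"
    and F: "F \<in> sets M" "emeasure M F < \<infinity>" "ennreal v < emeasure M F"
  shows "\<exists>G\<in>sets M. ennreal (v / 2) \<le> emeasure M G \<and> emeasure M G \<le> ennreal v"
proof (rule ccontr)
  assume neg: "\<not> ?thesis"
  have gap: "emeasure M G < ennreal (v / 2)" if "G \<in> sets M" "emeasure M G \<le> ennreal v" for G
    using neg that by (meson not_le)
  define C where "C = {G \<in> sets M. G \<subseteq> F \<and> emeasure M G \<le> ennreal v}"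
  \<comment> \<open>\<open>gap\<close> improves the bound \<open>v\<close> to \<open>v / 2\<close>,
    so two members of \<open>C\<close> together still have measure at most \<open>v\<close>.\<close>
  have C_Un: "G \<union> H \<in> C" if "G \<in> C" "H \<in> C" for G H
  proof -
    have "emeasure M (G \<union> H) \<le> emeasure M G + emeasure M H"
      using that by (intro emeasure_subadditive) (auto simp: C_def)
    also have "\<dots> \<le> ennreal (v / 2) + ennreal (v / 2)"
      using that gap by (intro add_mono less_imp_le) (auto simp: C_def)
    also have "\<dots> = ennreal v"
      using v by (simp flip: ennreal_plus)
    finally show ?thesis using that by (auto simp: C_def)
  qed
  have "{} \<in> C" by (auto simp: C_def)
  then have "C \<noteq> {}" by auto
  then obtain g where g: "range g \<subseteq> emeasure M ` C" "(SUP G\<in>C. emeasure M G) = (SUP n::nat. g n)"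
    using ennreal_Sup_countable_SUP[of "emeasure M ` C"] by auto
  then have "\<forall>n. \<exists>G\<in>C. g n = emeasure M G" by auto
  then obtain K where K: "\<And>n. K n \<in> C" "\<And>n. g n = emeasure M (K n)" by metis
  \<comment> \<open>The measures of the \<open>K n\<close> approach the supremum over
    \<open>C\<close>. Their finite unions increase and stay in \<open>C\<close>, so by continuity
    from below the limit \<open>U\<close> is still in \<open>C\<close> and attains that
    supremum.\<close>
  define H where "H n = (\<Union>i\<le>n. K i)" for n
  have HC: "H n \<in> C" for n
    by (induction n) (auto simp: H_def K atMost_Suc intro: C_Un)
  have incH: "incseq H" unfolding H_def by (intro monoI UN_mono) auto
  define U where "U = (\<Union>n. H n)"
  have U: "emeasure M U = (SUP n. emeasure M (H n))"
    unfolding U_def using HC incH by (intro SUP_emeasure_incseq[symmetric]) (auto simp: C_def)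
  have UC: "U \<in> C"
    using HC U by (auto simp: C_def U_def intro!: SUP_least)
  have Umax: "emeasure M G \<le> emeasure M U" if "G \<in> C" for G
  proof -
    have "emeasure M G \<le> (SUP n. g n)" using that g(2) by (metis SUP_upper)
    also have "\<dots> \<le> emeasure M U"
      unfolding K(2) using UC by (intro SUP_least emeasure_mono) (auto simp: C_def U_def H_def)
    finally show ?thesis .
  qed
  define D where "D = F - U"
  have Ufin: "emeasure M U < \<infinity>" using UC by (auto simp: C_def intro: le_less_trans)
  \<comment> \<open>A non-null \<open>T\<close> of measure at most \<open>v\<close> could be added
    to \<open>U\<close> inside \<open>C\<close>, contradicting maximality; the finite measure of
    \<open>U\<close> allows the cancellation.\<close>
  have null_or_big: "emeasure M T = 0 \<or> ennreal v < emeasure M T" if T: "T \<in> sets M" "T \<subseteq> D" for T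
  proof (rule ccontr)
    assume *: "\<not> ?thesis"
    then have "T \<in> C" using T by (auto simp: C_def D_def)
    then have "emeasure M (U \<union> T) \<le> emeasure M U" using UC C_Un Umax by blast
    moreover have "emeasure M (U \<union> T) = emeasure M U + emeasure M T"
      using T UC by (intro plus_emeasure[symmetric]) (auto simp: C_def D_def)
    ultimately show False using * Ufin
      by (metis add.right_neutral ennreal_add_left_cancel_le infinity_ennreal_def le_zero_eq less_irrefl)
  qed
  have Dm: "D \<in> sets M" using F UC by (auto simp: D_def C_def)
  have fin: "emeasure M T < \<infinity>" if "T \<in> sets M" "T \<subseteq> D" for T
    using that F emeasure_mono[of T F M] unfolding D_def by (meson Diff_subset le_less_trans subset_trans)
  have "emeasure M D \<noteq> 0"
  proof
    assume "emeasure M D = 0"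
    moreover have "emeasure M F = emeasure M U + emeasure M D"
      using UC F plus_emeasure[of U M D] Dm by (auto simp: C_def D_def Un_absorb1)
    ultimately show False using UC F(3) by (auto simp: C_def)
  qed
  define P where "P = {T \<in> sets M. T \<subseteq> D \<and> emeasure M T \<noteq> 0}"
  define i where "i = (INF T\<in>P. measure M T)"
  have "D \<in> P" using Dm \<open>emeasure M D \<noteq> 0\<close> by (auto simp: P_def)
  have bdd: "bdd_below (measure M ` P)" by (auto intro: bdd_belowI[of _ 0])
  obtain T where T: "T \<in> P" "measure M T < i + v"
    using \<open>D \<in> P\<close> v bdd cINF_less_iff[of P "measure M" "i + v"] unfolding i_def by auto
  have emT: "emeasure M S = ennreal (measure M S)" if "S \<in> sets M" "S \<subseteq> D" for S
    using fin[OF that] by (simp add: emeasure_eq_ennreal_measure)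
  have "atom_of M T"
    unfolding atom_of_def
  proof (intro conjI ballI impI)
    show "T \<in> sets M" "0 < emeasure M T" using T by (auto simp: P_def zero_less_iff_neq_zero)
    fix S assume S: "S \<in> sets M" "S \<subseteq> T"
    \<comment> \<open>If \<open>S\<close> split \<open>T\<close> properly, then \<open>S\<close>
      would have measure at least \<open>i\<close> and the non-null rest \<open>T - S\<close> more
      than \<open>v\<close>, whereas \<open>T\<close> has measure below
      \<open>i + v\<close>.\<close>
    show "emeasure M S = 0 \<or> emeasure M S = emeasure M T"
    proof (rule ccontr)
      assume *: "\<not> ?thesis"
      have SD: "S \<subseteq> D" and TD: "T \<subseteq> D" and Tm: "T \<in> sets M" using S T by (auto simp: P_def)
      then have "S \<in> P" using S * by (auto simp: P_def)
      then have iS: "i \<le> measure M S" unfolding i_def using bdd by (auto intro: cINF_lower)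
      have sum: "emeasure M T = emeasure M S + emeasure M (T - S)"
        using S Tm plus_emeasure[of S M "T - S"] by (auto simp: Un_absorb1)
      then have "emeasure M (T - S) \<noteq> 0" using * by auto
      then have "ennreal v < emeasure M (T - S)"
        using null_or_big[of "T - S"] S Tm TD by auto
      then have "v < measure M (T - S)"
        using v emT[OF sets.Diff[OF Tm S(1)]] TD
        by (metis Diff_subset ennreal_less_iff less_imp_le subset_trans)
      moreover have "measure M T = measure M S + measure M (T - S)"
        using measure_Union[of M S "T - S"] S Tm SD fin[of S] fin[of "T - S"] TD
        by (auto simp: Un_absorb1 less_top)
      ultimately show False using T(2) iS by simp
    qed
  qed
  then show False using na by (auto simp: nonatomic_def)
qed

section \<open>Young functions\<close>

context
  fixes A :: "ennreal \<Rightarrow> ennreal"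
  assumes A: "young_function A"
begin

lemma young_zero: "A 0 = 0"
  using A by (auto simp: young_function_def)

text \<open>Convexity on the segment from 0 to \<open>t\<close>, where the endpoint 0 contributes
  nothing because \<open>A 0 = 0\<close>. Every quantitative estimate on Young functions below rests
  on it.\<close>

lemma young_scale:
  assumes "0 \<le> u" "u \<le> 1" "t < \<infinity>"
  shows "A (ennreal u * t) \<le> ennreal u * A t"
proof -
  have "A (ennreal (1 - u) * 0 + ennreal u * t) \<le> ennreal (1 - u) * A 0 + ennreal u * A t"
    using A assms ennreal_zero_less_top unfolding young_function_def infinity_ennreal_def by blast
  then show ?thesis by (simp add: young_zero)
qed

lemma young_mono_finite:
  assumes "s \<le> t" "t < \<infinity>"
  shows "A s \<le> A t"
proof (cases "t = 0")
  case True
  then show ?thesis using assms by simp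
next
  case False
  obtain s' t' where st: "s = ennreal s'" "t = ennreal t'" "0 \<le> s'" "0 \<le> t'"
    using assms by (metis ennreal_cases infinity_ennreal_def less_irrefl less_le_trans not_less top.extremum_unique)
  have le: "s' \<le> t'" "0 < t'" using st assms False by (auto simp: ennreal_le_iff order_less_le)
  have "A s = A (ennreal (s' / t') * t)"
    using st le by (simp flip: ennreal_mult)
  also have "\<dots> \<le> ennreal (s' / t') * A t"
    using st le assms by (intro young_scale) auto
  also have "\<dots> \<le> 1 * A t"
    using st le by (intro mult_right_mono) auto
  finally show ?thesis by simp
qed

text \<open>At infinity left-continuity takes over from convexity: \<open>A top\<close> is a limit
  of values at points below \<open>top\<close>, which eventually dominate \<open>A s\<close>, and
  the left filter at \<open>top\<close> is nontrivial by density.\<close>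

lemma young_mono:
  assumes "s \<le> t"
  shows "A s \<le> A t"
proof (cases "t < \<infinity>")
  case True
  then show ?thesis using assms young_mono_finite by blast
next
  case False
  then have t: "t = top" by (simp add: not_less top_unique)
  show ?thesis
  proof (cases "s = top")
    case True
    then show ?thesis using t by simp
  next
    case False
    then have s: "s < top" by (simp add: less_top)
    have lim: "(A \<longlongrightarrow> A top) (at_left top)"
      using A by (auto simp: young_function_def)
    have "eventually (\<lambda>x. A s \<le> A x) (at_left top)"
      using s by (auto simp: eventually_at_left[OF s] intro!: exI[of _ s] young_mono_finite)
    moreover have "at_left (top::ennreal) \<noteq> bot"
      by (auto simp: trivial_limit_def eventually_at_left[OF s] dest: dense)
    ultimately show ?thesis
      using t tendsto_lowerbound[OF lim] by auto
  qed
qed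

text \<open>Non-constancy on the positive reals excludes the constant \<infinity>; in
  \<open>young_pos\<close> it excludes the constant 0.\<close>

lemma young_finite_pos:
  obtains t where "0 < t" "A (ennreal t) < \<infinity>"
proof -
  have "\<not> (\<forall>t. 0 < t \<longrightarrow> t < \<infinity> \<longrightarrow> A t = \<infinity>)"
    using A unfolding young_function_def by blast
  then obtain t where t: "0 < t" "t < \<infinity>" "A t \<noteq> \<infinity>" by blast
  then obtain t' where "t = ennreal t'" "0 \<le> t'"
    by (cases t) auto
  with t that[of t'] show ?thesis by (auto simp: less_top)
qed

lemma young_pos:
  obtains t where "0 < t" "0 < A (ennreal t)"
proof -
  have "\<not> (\<forall>t. 0 < t \<longrightarrow> t < \<infinity> \<longrightarrow> A t = 0)"
    using A unfolding young_function_def by blast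
  then obtain t where t: "0 < t" "t < \<infinity>" "A t \<noteq> 0" by blast
  then obtain t' where "t = ennreal t'" "0 \<le> t'"
    by (cases t) auto
  with t that[of t'] show ?thesis by (auto simp: zero_less_iff_neq_zero)
qed

text \<open>Near zero the graph lies below the chord from the origin to a point with a finite
  value.\<close>

lemma young_small_near_zero:
  assumes "0 < e"
  shows "\<exists>d>0. \<forall>t. 0 < t \<longrightarrow> t < d \<longrightarrow> A (ennreal t) \<le> ennreal e"
proof -
  obtain s where s: "0 < s" "A (ennreal s) < \<infinity>" by (rule young_finite_pos)
  obtain b where b: "A (ennreal s) = ennreal b" "0 \<le> b" using s by (cases "A (ennreal s)") auto
  \<comment> \<open>Below \<open>s\<close> the scaling factor \<open>t / s\<close> is at most 1; the
    second bound makes the chord at most \<open>e\<close>, with \<open>b + 1\<close> in place of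
    \<open>b\<close> to cover \<open>b = 0\<close>.\<close>
  define d where "d = min s (e * s / (b + 1))"
  have "0 < d" using s b assms by (auto simp: d_def)
  moreover have "A (ennreal t) \<le> ennreal e" if t: "0 < t" "t < d" for t
  proof -
    have "A (ennreal t) = A (ennreal (t / s) * ennreal s)"
      using s t by (simp flip: ennreal_mult)
    also have "\<dots> \<le> ennreal (t / s) * A (ennreal s)"
      using s t by (intro young_scale) (auto simp: d_def)
    also have "\<dots> = ennreal (t / s * b)"
      using s t b by (simp flip: ennreal_mult)
    also have "\<dots> \<le> ennreal e"
    proof (rule ennreal_leI)
      have "t * (b + 1) \<le> e * s" using t b by (simp add: d_def field_simps)
      then have "t * b \<le> e * s" using t by (simp add: algebra_simps)
      then show "t / s * b \<le> e" using s by (simp add: field_simps)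
    qed
    finally show ?thesis .
  qed
  ultimately show ?thesis by blast
qed

end

section \<open>Orlicz norms\<close>

lemma orlicz_norm_le:
  assumes "0 < r" "(\<integral>\<^sup>+ x. A (e2ennreal \<bar>f x\<bar> / ennreal r) \<partial>M) \<le> 1"
  shows "orlicz_norm A M f \<le> ennreal r"
  unfolding orlicz_norm_def using assms by (intro Inf_lower) auto

lemma orlicz_norm_lessE:
  assumes "orlicz_norm A M f < ennreal c"
  obtains r where "0 < r" "r < c" "(\<integral>\<^sup>+ x. A (e2ennreal \<bar>f x\<bar> / ennreal r) \<partial>M) \<le> 1"
  using assms unfolding orlicz_norm_def Inf_less_iff
  by (auto simp: ennreal_less_iff)

text \<open>Some admissible divisor lies below \<open>c\<close>, and a larger divisor only decreases
  the modular. The strict inequality avoids the question whether the infimum is attained.\<close>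

lemma orlicz_modular_le_one:
  assumes A: "young_function A" and "orlicz_norm A M f < ennreal c"
  shows "(\<integral>\<^sup>+ x. A (e2ennreal \<bar>f x\<bar> / ennreal c) \<partial>M) \<le> 1"
proof -
  obtain r where r: "0 < r" "r < c" "(\<integral>\<^sup>+ x. A (e2ennreal \<bar>f x\<bar> / ennreal r) \<partial>M) \<le> 1"
    using assms(2) by (rule orlicz_norm_lessE)
  have "(\<integral>\<^sup>+ x. A (e2ennreal \<bar>f x\<bar> / ennreal c) \<partial>M) \<le> (\<integral>\<^sup>+ x. A (e2ennreal \<bar>f x\<bar> / ennreal r) \<partial>M)"
    using r by (intro nn_integral_mono young_mono[OF A])
      (auto simp: divide_ennreal_def inverse_ennreal intro!: mult_left_mono ennreal_leI)
  then show ?thesis using r(3) by (rule order_trans)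
qed

text \<open>Off \<open>S\<close> the integrand vanishes since \<open>A 0 = 0\<close>. Stating the
  shape of \<open>f\<close> pointwise lets products of indicators be treated directly, with
  \<open>S = G - E\<close> in the main application.\<close>

lemma nn_integral_young_indicator:
  assumes A: "young_function A" and S: "S \<in> sets M" and "0 \<le> t" "0 < r"
    and f: "\<And>x. x \<in> space M \<Longrightarrow> f x = ereal t * indicator S x"
  shows "(\<integral>\<^sup>+ x. A (e2ennreal \<bar>f x\<bar> / ennreal r) \<partial>M) = A (ennreal (t / r)) * emeasure M S"
proof -
  have "(\<integral>\<^sup>+ x. A (e2ennreal \<bar>f x\<bar> / ennreal r) \<partial>M)
      = (\<integral>\<^sup>+ x. A (ennreal (t / r)) * indicator S x \<partial>M)"
    using assms young_zero[OF A]
    by (intro nn_integral_cong) (auto simp: indicator_def divide_ennreal zero_ennreal.abs_eq[symmetric])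
  also have "\<dots> = A (ennreal (t / r)) * emeasure M S"
    using S by (rule nn_integral_cmult_indicator)
  finally show ?thesis .
qed

section \<open>The two implications\<close>

lemma tendsto_zero_ennrealI:
  fixes f :: "'a \<Rightarrow> ennreal"
  assumes "\<And>e. 0 < e \<Longrightarrow> eventually (\<lambda>x. f x \<le> ennreal e) F"
  shows "(f \<longlongrightarrow> 0) F"
proof (rule order_tendstoI)
  fix c :: ennreal assume "0 < c"
  then obtain e where e: "0 < e" "ennreal e < c"
    by (metis dense ennreal_cases order_le_neq_trans order_less_asym)
  show "eventually (\<lambda>x. f x < c) F"
    using assms[OF e(1)] by eventually_elim (use e in \<open>auto intro: le_less_trans\<close>)
qed auto

lemma embeds_star_infinity_if_dominated:
  fixes M :: "'a measure"
  assumes A: "young_function A" and B: "young_function B" and dom: "A \<lless>\<^sub>0 B"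
  shows "embeds_star_infinity M (orlicz_norm B M) (orlicz_norm A M)"
proof -
  define \<Phi> where "\<Phi> = (\<lambda>a::real. SUP f\<in>{f \<in> borel_measurable M. orlicz_norm B M f \<le> 1}.
          INF E\<in>{E \<in> sets M. emeasure M E \<le> ennreal a}.
            orlicz_norm A M (\<lambda>x. f x * indicator (space M - E) x))"
  have key: "eventually (\<lambda>a. \<Phi> a \<le> ennreal e) at_top" if e: "0 < e" for e :: real
  proof -
    \<comment> \<open>The factor \<open>2 / e\<close> converts the divisor 2, used for the modular
      of \<open>B\<close>, into the divisor \<open>e\<close> wanted for \<open>A\<close>.\<close>
    have "((\<lambda>t::real. A (ennreal (2 / e * t)) / B (ennreal t)) \<longlongrightarrow> 0) (at_right 0)"
      by (rule dom[unfolded essentially_dominated_near_zero_def, THEN conjunct2, rule_format])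
        (use e in simp)
    then have "eventually (\<lambda>t. A (ennreal (2 / e * t)) / B (ennreal t) < 1) (at_right 0)"
      by (rule order_tendstoD) auto
    then obtain d0 where d0: "0 < d0"
      "\<And>t. 0 < t \<Longrightarrow> t < d0 \<Longrightarrow> A (ennreal (2 / e * t)) / B (ennreal t) < 1"
      by (auto simp: eventually_at_right[OF zero_less_one])
    obtain d1 where d1: "0 < d1" "B (ennreal d1) < \<infinity>" by (rule young_finite_pos[OF B])
    \<comment> \<open>Below \<open>d0\<close> the quotient is less than 1; up to \<open>d1\<close>
      the value of \<open>B\<close> is finite, so the quotient can be multiplied out and
      \<open>B d\<close> is a real number.\<close>
    define d where "d = min d0 d1"
    have d: "0 < d" using d0 d1 by (auto simp: d_def)
    have Bfin: "B (ennreal t) < \<infinity>" if "t \<le> d" for t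
      using young_mono[OF B, of "ennreal t" "ennreal d1"] d1 that
      by (auto simp: d_def intro: le_less_trans ennreal_leI)
    have Bpos: "0 < B t" if "0 < t" for t
      using dom that by (auto simp: essentially_dominated_near_zero_def)
    have AB: "A (ennreal (2 / e * t)) \<le> B (ennreal t)" if "0 \<le> t" "t < d" for t
    proof (cases "t = 0")
      case True
      then show ?thesis by (simp add: young_zero[OF A])
    next
      case False
      with that have t: "0 < t" "t < d0" by (auto simp: d_def)
      then have "A (ennreal (2 / e * t)) / B (ennreal t) * B (ennreal t) \<le> 1 * B (ennreal t)"
        by (intro mult_right_mono less_imp_le[OF d0(2)]) auto
      then show ?thesis
        using Bpos[of "ennreal t"] Bfin[of t] that t
        by (simp add: ennreal_divide_times ennreal_divide_self zero_less_iff_neq_zero)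
    qed
    obtain b where b: "B (ennreal d) = ennreal b" "0 < b"
      using Bfin[of d] Bpos[of "ennreal d"] d by (cases "B (ennreal d)") auto
    \<comment> \<open>Markov's inequality bounds the measure of every exceptional set by
      \<open>1 / b\<close>, independently of \<open>f\<close>.\<close>
    have "\<Phi> a \<le> ennreal e" if a: "1 / b \<le> a" for a
      unfolding \<Phi>_def
    proof (rule SUP_least)
      fix f assume "f \<in> {f \<in> borel_measurable M. orlicz_norm B M f \<le> 1}"
      then have f[measurable]: "f \<in> borel_measurable M" and "orlicz_norm B M f \<le> 1" by auto
      \<comment> \<open>Passing from norm at most 1 to norm below 2 makes the modular bound
        available at the divisor 2.\<close>
      then have "orlicz_norm B M f < ennreal 2"
        by (metis ennreal_1 ennreal_less_iff le_less_trans one_less_numeral_iff semiring_norm(76) zero_le_one)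
      then have mod: "(\<integral>\<^sup>+ x. B (e2ennreal \<bar>f x\<bar> / ennreal 2) \<partial>M) \<le> 1"
        by (rule orlicz_modular_le_one[OF B])
      \<comment> \<open>Points where \<open>f\<close> is infinite belong to \<open>E\<close>, so
        outside \<open>E\<close> the modulus of \<open>f\<close> is a real number \<open>s\<close>
        with \<open>s / 2 < d\<close>.\<close>
      define E where "E = {x \<in> space M. ennreal d \<le> e2ennreal \<bar>f x\<bar> / ennreal 2}"
      have E[measurable]: "E \<in> sets M" unfolding E_def by measurable
      have "ennreal b * emeasure M E = (\<integral>\<^sup>+ x. ennreal b * indicator E x \<partial>M)"
        by (simp add: nn_integral_cmult_indicator)
      also have "\<dots> \<le> (\<integral>\<^sup>+ x. B (e2ennreal \<bar>f x\<bar> / ennreal 2) \<partial>M)"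
        using young_mono[OF B, of "ennreal d"] b
        by (intro nn_integral_mono) (auto simp: indicator_def E_def)
      finally have *: "ennreal b * emeasure M E \<le> 1" using mod by simp
      then have "emeasure M E \<noteq> top" using b by (auto simp: ennreal_mult_top top_unique)
      then obtain m where m: "emeasure M E = ennreal m" "0 \<le> m" by (cases "emeasure M E") auto
      then have "b * m \<le> 1" using * b by (simp flip: ennreal_mult)
      then have "m \<le> a" using a b by (smt (verit) le_divide_eq mult.commute)
      then have Ea: "emeasure M E \<le> ennreal a" using m by (simp add: ennreal_leI)
      have "(\<integral>\<^sup>+ x. A (e2ennreal \<bar>f x * indicator (space M - E) x\<bar> / ennreal e) \<partial>M)
          \<le> (\<integral>\<^sup>+ x. B (e2ennreal \<bar>f x\<bar> / ennreal 2) \<partial>M)"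
      proof (rule nn_integral_mono)
        fix x assume x: "x \<in> space M"
        show "A (e2ennreal \<bar>f x * indicator (space M - E) x\<bar> / ennreal e) \<le> B (e2ennreal \<bar>f x\<bar> / ennreal 2)"
        proof (cases "x \<in> E")
          case True
          then show ?thesis using young_zero[OF A] by (simp flip: zero_ennreal.abs_eq)
        next
          case False
          then have lt: "e2ennreal \<bar>f x\<bar> / ennreal 2 < ennreal d" using x by (auto simp: E_def not_le)
          then have "e2ennreal \<bar>f x\<bar> \<noteq> top"
            by (auto simp: ennreal_top_divide)
          then obtain s where s: "e2ennreal \<bar>f x\<bar> = ennreal s" "0 \<le> s"
            by (cases "e2ennreal \<bar>f x\<bar>") auto
          then have "s / 2 < d" using lt by (simp add: divide_ennreal ennreal_less_iff del: ennreal_numeral)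
          then have "A (ennreal (2 / e * (s / 2))) \<le> B (ennreal (s / 2))" using s by (intro AB) auto
          then show ?thesis using s e False x by (simp add: divide_ennreal del: ennreal_numeral)
        qed
      qed
      then have "orlicz_norm A M (\<lambda>x. f x * indicator (space M - E) x) \<le> ennreal e"
        using mod e by (intro orlicz_norm_le) auto
      then show "(INF E\<in>{E \<in> sets M. emeasure M E \<le> ennreal a}.
            orlicz_norm A M (\<lambda>x. f x * indicator (space M - E) x)) \<le> ennreal e"
        using E Ea by (intro INF_lower2[of E]) auto
    qed
    then show ?thesis by (auto simp: eventually_at_top_linorder)
  qed
  have "(\<Phi> \<longlongrightarrow> 0) at_top" by (rule tendsto_zero_ennrealI) (rule key)
  then show ?thesis unfolding embeds_star_infinity_def \<Phi>_def .
qed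

text \<open>The supremum over the unit ball is below \<open>e\<close> for some \<open>a\<close>, so
  one \<open>a\<close> serves all \<open>f\<close>. Strictness then yields a set \<open>E\<close>
  for each \<open>f\<close> and an admissible divisor \<open>r\<close> below
  \<open>e\<close>.\<close>

lemma embeds_star_infinityD:
  fixes M :: "'a measure"
  assumes "embeds_star_infinity M X (orlicz_norm A M)" "0 < e"
  shows "\<exists>a>0. \<forall>f\<in>borel_measurable M. X f \<le> 1 \<longrightarrow>
      (\<exists>E\<in>sets M. emeasure M E \<le> ennreal a \<and> (\<exists>r>0. r < e \<and>
        (\<integral>\<^sup>+ x. A (e2ennreal \<bar>f x * indicator (space M - E) x\<bar> / ennreal r) \<partial>M) \<le> 1))"
proof -
  have "eventually (\<lambda>a::real. (SUP f\<in>{f \<in> borel_measurable M. X f \<le> 1}.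
          INF E\<in>{E \<in> sets M. emeasure M E \<le> ennreal a}.
            orlicz_norm A M (\<lambda>x. f x * indicator (space M - E) x)) < ennreal e) at_top"
    using assms by (intro order_tendstoD) (auto simp: embeds_star_infinity_def)
  from eventually_conj[OF this eventually_gt_at_top[of 0]] obtain a :: real where a: "0 < a"
    "(SUP f\<in>{f \<in> borel_measurable M. X f \<le> 1}.
          INF E\<in>{E \<in> sets M. emeasure M E \<le> ennreal a}.
            orlicz_norm A M (\<lambda>x. f x * indicator (space M - E) x)) < ennreal e"
    by (auto dest!: eventually_happens)
  show ?thesis
  proof (intro exI[of _ a] conjI a(1) ballI impI)
    fix f :: "'a \<Rightarrow> ereal" assume "f \<in> borel_measurable M" "X f \<le> 1"
    then have "(INF E\<in>{E \<in> sets M. emeasure M E \<le> ennreal a}.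
            orlicz_norm A M (\<lambda>x. f x * indicator (space M - E) x)) < ennreal e"
      using a(2) by (intro le_less_trans[OF _ a(2)] SUP_upper) auto
    then obtain E where E: "E \<in> sets M" "emeasure M E \<le> ennreal a"
      and "orlicz_norm A M (\<lambda>x. f x * indicator (space M - E) x) < ennreal e"
      by (auto simp: INF_less_iff)
    from this(3) obtain r where "0 < r" "r < e"
      "(\<integral>\<^sup>+ x. A (e2ennreal \<bar>f x * indicator (space M - E) x\<bar> / ennreal r) \<partial>M) \<le> 1"
      by (rule orlicz_norm_lessE)
    with E show "\<exists>E\<in>sets M. emeasure M E \<le> ennreal a \<and> (\<exists>r>0. r < e \<and>
        (\<integral>\<^sup>+ x. A (e2ennreal \<bar>f x * indicator (space M - E) x\<bar> / ennreal r) \<partial>M) \<le> 1)"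
      by blast
  qed
qed

text \<open>If \<open>B\<close> vanished at a positive value, a positive constant would lie in the
  unit ball. Removing a set of finite measure leaves it on a set of infinite measure, where the
  modular of \<open>A\<close> with a small divisor is infinite.\<close>

lemma embeds_star_infinity_imp_pos:
  fixes M :: "'a measure"
  assumes inf: "emeasure M (space M) = \<infinity>"
    and A: "young_function A" and B: "young_function B"
    and emb: "embeds_star_infinity M (orlicz_norm B M) (orlicz_norm A M)"
    and t: "0 < t"
  shows "0 < B t"
proof (rule ccontr)
  assume "\<not> 0 < B t"
  \<comment> \<open>\<open>t\<close> may be infinite, so a real value below it is used;
    \<open>B\<close> vanishes there by monotonicity.\<close>
  obtain t0 where t0: "0 < t0" "ennreal t0 \<le> t"
  proof (cases t)
    case (real r)
    then show ?thesis using t that[of r] by auto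
  next
    case top
    then show ?thesis using that[of 1] by auto
  qed
  have B0: "B (ennreal t0) = 0"
    using young_mono[OF B t0(2)] \<open>\<not> 0 < B t\<close> by simp
  obtain s where s: "0 < s" "0 < A (ennreal s)" by (rule young_pos[OF A])
  \<comment> \<open>A divisor \<open>r\<close> below \<open>t0 / s\<close> gives
    \<open>t0 / r\<close> above \<open>s\<close>, where \<open>A\<close> is positive.\<close>
  have ts: "0 < t0 / s" using s t0 by simp
  obtain a where "0 < a" and a: "\<forall>f\<in>borel_measurable M. orlicz_norm B M f \<le> 1 \<longrightarrow>
      (\<exists>E\<in>sets M. emeasure M E \<le> ennreal a \<and> (\<exists>r>0. r < t0 / s \<and>
        (\<integral>\<^sup>+ x. A (e2ennreal \<bar>f x * indicator (space M - E) x\<bar> / ennreal r) \<partial>M) \<le> 1))"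
    using embeds_star_infinityD[OF emb ts] by blast
  have "orlicz_norm B M (\<lambda>x. ereal t0) \<le> ennreal 1"
    using t0 B0 by (intro orlicz_norm_le) (auto simp: divide_ennreal_def)
  then obtain E r where E: "E \<in> sets M" "emeasure M E \<le> ennreal a" and r: "0 < r" "r < t0 / s"
    and int: "(\<integral>\<^sup>+ x. A (e2ennreal \<bar>ereal t0 * indicator (space M - E) x\<bar> / ennreal r) \<partial>M) \<le> 1"
    using a[rule_format, of "\<lambda>x. ereal t0"] by auto
  have "emeasure M (space M - E) = \<infinity>"
    using E inf by (subst emeasure_compl) (auto simp: top_unique ennreal_top_minus)
  moreover have "A (ennreal (t0 / r)) * emeasure M (space M - E) \<le> 1"
    using int E r t0 by (subst (asm) nn_integral_young_indicator[OF A]) auto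
  moreover have "0 < A (ennreal (t0 / r))"
  proof -
    have "s \<le> t0 / r" using r s by (simp add: field_simps)
    then show ?thesis using young_mono[OF A, of "ennreal s" "ennreal (t0 / r)"] s(2)
      by (auto intro: less_le_trans ennreal_leI)
  qed
  ultimately show False by (auto simp: ennreal_mult_top top_unique split: if_splits)
qed

text \<open>The gain comes from the small divisor \<open>r\<close>: the test function gives
  \<open>A (t / r)\<close> at most \<open>4 * B t\<close>, and convexity then bounds
  \<open>A (q * t)\<close> by \<open>q * r\<close> times this.\<close>

lemma embeds_star_infinity_imp_tendsto:
  fixes M :: "'a measure"
  assumes sf: "sigma_finite_measure M" and na: "nonatomic M"
    and inf: "emeasure M (space M) = \<infinity>"
    and A: "young_function A" and B: "young_function B"
    and emb: "embeds_star_infinity M (orlicz_norm B M) (orlicz_norm A M)"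
    and q: "0 < q"
  shows "((\<lambda>t::real. A (ennreal (q * t)) / B (ennreal t)) \<longlongrightarrow> 0) (at_right 0)"
proof -
  have key: "eventually (\<lambda>t. A (ennreal (q * t)) / B (ennreal t) \<le> ennreal e) (at_right 0)"
    if e: "0 < e" for e
  proof -
    \<comment> \<open>The first bound keeps the factor \<open>q * r\<close> at most 1, as convexity
      requires; the second absorbs the constant 4 from \<open>zb\<close>.\<close>
    define \<eta> where "\<eta> = min (1 / q) (e / (4 * q))"
    have \<eta>: "0 < \<eta>" "q * \<eta> \<le> 1" "4 * (q * \<eta>) \<le> e"
      using e q by (auto simp: \<eta>_def min_def field_simps)
    obtain a where a: "0 < a" "\<forall>f\<in>borel_measurable M. orlicz_norm B M f \<le> 1 \<longrightarrow>
      (\<exists>E\<in>sets M. emeasure M E \<le> ennreal a \<and> (\<exists>r>0. r < \<eta> \<and>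
        (\<integral>\<^sup>+ x. A (e2ennreal \<bar>f x * indicator (space M - E) x\<bar> / ennreal r) \<partial>M) \<le> 1))"
      using embeds_star_infinityD[OF emb \<eta>(1)] by blast
    \<comment> \<open>For \<open>B t = b\<close> this level means
      \<open>a \<le> 1 / (4 * b)\<close>: the removed set takes at most half of the
      \<open>1 / (2 * b)\<close> guaranteed for \<open>G\<close>.\<close>
    obtain d where d: "0 < d" "\<And>t. 0 < t \<Longrightarrow> t < d \<Longrightarrow> B (ennreal t) \<le> ennreal (1 / (4 * a))"
      using young_small_near_zero[OF B, of "1 / (4 * a)"] a(1) by auto
    have "A (ennreal (q * t)) / B (ennreal t) \<le> ennreal e" if t: "0 < t" "t < d" for t
    proof -
      have "B (ennreal t) \<noteq> top" using d(2)[OF t] by (auto simp: top_unique)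
      moreover have "0 < B (ennreal t)"
        using embeds_star_infinity_imp_pos[OF inf A B emb] t by simp
      ultimately obtain b where b: "B (ennreal t) = ennreal b" "0 < b"
        by (cases "B (ennreal t)") auto
      have ab: "b \<le> 1 / (4 * a)" using d(2)[OF t] b a(1) by (simp add: ennreal_le_iff)
      \<comment> \<open>Sigma-finiteness and infinite total measure provide a set of finite measure
        above \<open>1 / b\<close>, from which \<open>G\<close> is obtained.\<close>
      obtain F where F: "F \<in> sets M" "emeasure M F < \<infinity>" "ennreal (1 / b) < emeasure M F"
        using sigma_finite_measure.approx_PInf_emeasure_with_finite[OF sf sets.top inf, of "1 / b"]
        by metis
      obtain G where G[measurable]: "G \<in> sets M"
        and Glo: "ennreal (1 / b / 2) \<le> emeasure M G" and Ghi: "emeasure M G \<le> ennreal (1 / b)"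
        using nonatomic_subset_comparable[OF na _ F] b(2) by auto
      have "(\<integral>\<^sup>+ x. B (e2ennreal \<bar>ereal t * indicator G x\<bar> / ennreal 1) \<partial>M) = ennreal b * emeasure M G"
        using t b by (subst nn_integral_young_indicator[OF B G]) auto
      also have "\<dots> \<le> ennreal b * ennreal (1 / b)"
        using Ghi by (intro mult_left_mono) auto
      also have "\<dots> = 1" using b(2) by (simp flip: ennreal_mult)
      finally have "orlicz_norm B M (\<lambda>x. ereal t * indicator G x) \<le> ennreal 1"
        by (intro orlicz_norm_le) auto
      then obtain E r where E: "E \<in> sets M" "emeasure M E \<le> ennreal a" and r: "0 < r" "r < \<eta>"
        and int: "(\<integral>\<^sup>+ x. A (e2ennreal \<bar>ereal t * indicator G x * indicator (space M - E) x\<bar> / ennreal r) \<partial>M) \<le> 1"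
        using a(2)[rule_format, of "\<lambda>x. ereal t * indicator G x"] by auto
      have "(\<integral>\<^sup>+ x. A (e2ennreal \<bar>ereal t * indicator G x * indicator (space M - E) x\<bar> / ennreal r) \<partial>M)
          = A (ennreal (t / r)) * emeasure M (G - E)"
        using E t r by (intro nn_integral_young_indicator[OF A]) (auto simp: indicator_def)
      with int have Aint: "A (ennreal (t / r)) * emeasure M (G - E) \<le> 1" by simp
      obtain g where g: "emeasure M G = ennreal g" "0 \<le> g"
        using Ghi by (cases "emeasure M G") (auto simp: top_unique)
      obtain h where h: "emeasure M (G - E) = ennreal h" "0 \<le> h"
        using emeasure_mono[of "G - E" G M] g by (cases "emeasure M (G - E)") (auto simp: top_unique)
      have "emeasure M G \<le> emeasure M (G - E) + emeasure M E"
        using E emeasure_subadditive[of "G - E" M E] emeasure_mono[of G "G - E \<union> E" M]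
        by (auto intro: order_trans)
      also have "\<dots> \<le> ennreal h + ennreal a" using E h by (intro add_mono) auto
      finally have "ennreal (1 / b / 2) \<le> ennreal (h + a)"
        using Glo h a(1) by (simp add: ennreal_plus)
      then have "1 / b / 2 \<le> h + a" using h a(1) by (simp add: ennreal_le_iff del: ennreal_plus)
      moreover have "a \<le> 1 / b / 4" using ab a(1) b(2) by (simp add: field_simps)
      \<comment> \<open>What survives the removal is at least
        \<open>1 / (2 * b) - 1 / (4 * b)\<close>; being positive, it also forces
        \<open>A (t / r)\<close> to be finite.\<close>
      ultimately have hb: "1 / b / 4 \<le> h"
        using b(2) by (simp add: field_simps)
      then have hpos: "0 < h" using b(2) by (meson divide_pos_pos less_le_trans zero_less_numeral zero_less_one)
      have "A (ennreal (t / r)) \<noteq> top" using Aint h hpos by (auto simp: ennreal_top_mult top_unique)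
      then obtain z where z: "A (ennreal (t / r)) = ennreal z" "0 \<le> z"
        by (cases "A (ennreal (t / r))") auto
      have "z * h \<le> 1" using Aint z h by (simp flip: ennreal_mult)
      moreover have "z * (1 / b / 4) \<le> z * h" using hb z by (intro mult_left_mono) auto
      ultimately have "z * (1 / b / 4) \<le> 1" by (rule order_trans[rotated])
      then have zb: "z \<le> 4 * b" using b(2) by (simp add: field_simps)
      have qr: "q * r \<le> q * \<eta>" using q r by simp
      have "A (ennreal (q * t)) = A (ennreal (q * r) * ennreal (t / r))"
        using q r t by (simp flip: ennreal_mult)
      also have "\<dots> \<le> ennreal (q * r) * A (ennreal (t / r))"
        using q r order_trans[OF qr \<eta>(2)] by (intro young_scale[OF A]) auto
      also have "\<dots> = ennreal (q * r * z)" using z q r by (simp flip: ennreal_mult)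
      also have "\<dots> \<le> ennreal (e * b)"
      proof (rule ennreal_leI)
        have "q * r * z \<le> q * \<eta> * (4 * b)" using qr zb z q r \<eta> by (intro mult_mono) auto
        also have "\<dots> = 4 * (q * \<eta>) * b" by simp
        also have "\<dots> \<le> e * b" using \<eta>(3) b(2) by (intro mult_right_mono) auto
        finally show "q * r * z \<le> e * b" .
      qed
      finally have "A (ennreal (q * t)) / B (ennreal t) \<le> ennreal (e * b) / ennreal b"
        unfolding b(1) by (rule divide_right_mono_ennreal)
      also have "\<dots> = ennreal e" using b(2) e by (simp add: divide_ennreal)
      finally show ?thesis .
    qed
    then show ?thesis using d(1) by (auto simp: eventually_at_right[OF zero_less_one])
  qed
  show ?thesis by (rule tendsto_zero_ennrealI) (rule key)
qed

theorem proposition6p5: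
  fixes M :: "'a measure" and A B :: "ennreal \<Rightarrow> ennreal"
  assumes "sigma_finite_measure M"
    and "nonatomic M"
    and "emeasure M (space M) = \<infinity>"
    and "young_function A"
    and "young_function B"
  shows "embeds_star_infinity M (orlicz_norm B M) (orlicz_norm A M) \<longleftrightarrow> A \<lless>\<^sub>0 B"
proof
  assume "embeds_star_infinity M (orlicz_norm B M) (orlicz_norm A M)"
  then show "A \<lless>\<^sub>0 B"
    unfolding essentially_dominated_near_zero_def
    using assms embeds_star_infinity_imp_pos embeds_star_infinity_imp_tendsto by blast
next
  assume "A \<lless>\<^sub>0 B"
  then show "embeds_star_infinity M (orlicz_norm B M) (orlicz_norm A M)"
    using assms embeds_star_infinity_if_dominated by blast
qed

end
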